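(* Let $A,B\in su(1,1)$ be linearly independent over $\mathbb{R}$. The single-input control system $\dot X(t)=[A+u(t)B]X(t)$, $X(0)=I_2$, on $SU(1,1)$, whose admissible controls are all locally bounded measurable functions $u:[0,\infty)\to\mathbb{R}$, is controllable on $SU(1,1)$ if and only if the set $$\Omega=\left\{u\in\mathbb{R}\;\middle|\;\langle A+uB,\,A^{\dagger}+uB^{\dagger}\rangle<0\right\}$$ is nonempty.
   Context: $SU(1,1)$ is the Lie group of complex matrices $\begin{pmatrix} a & b\\ \bar b & \bar a\end{pmatrix}$ with $|a|^2-|b|^2=1$. Its Lie algebra $su(1,1)$ is the real span of $\bar K_x=\frac12\begin{pmatrix}0&-i\\ i&0\end{pmatrix}$, $\bar K_y=\frac12\begin{pmatrix}0&-1\\-1&0\end{pmatrix}$, $\bar K_z=\frac12\begin{pmatrix}-i&0\\0&i\end{pmatrix}$. For matrices $M,N$ put $\langle M,N\rangle=2\,\mathrm{Tr}(MN^{\dagger})$, where $N^\dagger$ is the conjugate transpose of $N$; thus $\langle M,N^\dagger\rangle=2\,\mathrm{Tr}(MN)$. For $t\ge 0$, the reachable set $R(t)$ is the set of all $X_f\in SU(1,1)$ for which there is an admissible control whose corresponding solution with $X(0)=I_2$ satisfies $X(t)=X_f$. The system is controllable on $SU(1,1)$ if $\bigcup_{0\le t<\infty}R(t)=SU(1,1)$, and uncontrollable otherwise. *)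

theory Defs
  imports "HOL-Analysis.Analysis" "HOL-Library.Complex_Order"
begin

definition mat2 :: "complex \<Rightarrow> complex \<Rightarrow> complex \<Rightarrow> complex \<Rightarrow> complex^2^2" where
  "mat2 a b c d = vector [vector [a, b], vector [c, d]]"

definition SU11 :: "(complex^2^2) set" where
  "SU11 = {mat2 a b (cnj b) (cnj a) | a b. (cmod a)\<^sup>2 - (cmod b)\<^sup>2 = 1}"

definition Kx :: "complex^2^2" where
  "Kx = (1/2) *\<^sub>R mat2 0 (-\<i>) \<i> 0"

definition Ky :: "complex^2^2" where
  "Ky = (1/2) *\<^sub>R mat2 0 (-1) (-1) 0"

definition Kz :: "complex^2^2" where
  "Kz = (1/2) *\<^sub>R mat2 (-\<i>) 0 0 \<i>"

(* span is taken over the reals *)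
definition su11 :: "(complex^2^2) set" where
  "su11 = span {Kx, Ky, Kz}"

definition dagger :: "complex^'n^'m \<Rightarrow> complex^'m^'n" where
  "dagger M = (\<chi> i j. cnj (M $ j $ i))"

definition trace_form :: "complex^2^2 \<Rightarrow> complex^2^2 \<Rightarrow> complex" where
  "trace_form M N = 2 * trace (M ** dagger N)"

(* The order on complex numbers comes from Complex_Order: z < 0 means that z is real
   and negative. *)
definition Omega :: "complex^2^2 \<Rightarrow> complex^2^2 \<Rightarrow> real set" where
  "Omega A B = {u. trace_form (A + u *\<^sub>R B) (dagger A + u *\<^sub>R dagger B) < 0}"

(* Only the values on [0, \<infinity>) matter. *)
definition admissible_control :: "(real \<Rightarrow> real) \<Rightarrow> bool" where
  "admissible_control u \<longleftrightarrow>
     u \<in> borel_measurable (lebesgue_on {0..}) \<and> (\<forall>T\<ge>0. bounded (u ` {0..T}))"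

(* The usual epsilon-delta notion. A finite family of non-overlapping compact intervals
   is encoded as a division d of its own union. *)
definition abs_continuous_on :: "real set \<Rightarrow> (real \<Rightarrow> 'a::real_normed_vector) \<Rightarrow> bool" where
  "abs_continuous_on S f \<longleftrightarrow>
     (\<forall>\<epsilon>>0. \<exists>\<delta>>0. \<forall>d. d division_of \<Union>d \<and> \<Union>d \<subseteq> S \<and> (\<Sum>k\<in>d. Sup k - Inf k) < \<delta> \<longrightarrow>
        (\<Sum>k\<in>d. norm (f (Sup k) - f (Inf k))) < \<epsilon>)"

(* Solutions are in the sense of Caratheodory, since controls are merely measurable. *)
definition is_solution ::
  "complex^2^2 \<Rightarrow> complex^2^2 \<Rightarrow> (real \<Rightarrow> real) \<Rightarrow> (real \<Rightarrow> complex^2^2) \<Rightarrow> bool" where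
  "is_solution A B u X \<longleftrightarrow>
     X 0 = mat 1 \<and>
     (\<forall>T\<ge>0. abs_continuous_on {0..T} X) \<and>
     (AE t in lebesgue_on {0..}.
        (X has_vector_derivative ((A + u t *\<^sub>R B) ** X t)) (at t within {0..}))"

definition reachable_set :: "complex^2^2 \<Rightarrow> complex^2^2 \<Rightarrow> real \<Rightarrow> (complex^2^2) set" where
  "reachable_set A B t =
     {Xf \<in> SU11. \<exists>u X. admissible_control u \<and> is_solution A B u X \<and> X t = Xf}"

definition controllable :: "complex^2^2 \<Rightarrow> complex^2^2 \<Rightarrow> bool" where
  "controllable A B \<longleftrightarrow> (\<Union>t\<in>{0..}. reachable_set A B t) = SU11"

end

theory Submission
  imports Defs
begin

text \<open>
  In the basis of the context, \<open>\<langle>M, M\<^sup>\<dagger>\<rangle>\<close> is a Lorentzian form on the Lie algebra, and a negative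
  value means that \<open>M\<close> is elliptic: it generates a circle group. The theorem says that controllability
  holds exactly if the affine line \<open>A + u B\<close> contains an elliptic element.

  Suppose that it contains one. Nearby elements of the line are elliptic too, and an elliptic flow is
  periodic, so that negative times are available as well. By \<open>steerable_full_circle\<close> the trajectories
  with piecewise constant control reach everything generated by two distinct circle groups. In the
  action of SU(1,1) on the disc these are the rotations about two distinct points; after conjugation one
  of them is the centre, and \<open>rotations_and_one_more_generate_SU11\<close> shows by the Cartan (KAK)
  decomposition that they generate the whole group.

  Suppose that it contains none. SU(1,1) acts on the plane \<open>\<complex>\<close> by the real linear maps
  \<open>z \<mapsto> a z + b cnj z\<close> of determinant one. Let \<open>Q\<close> be the Hamiltonian of the vector field \<open>B\<close>. Along
  a trajectory the derivative of \<open>Q\<close> does not involve the control, since the flow of \<open>B\<close> conserves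
  \<open>Q\<close>; it is a multiple of the Hamiltonian of the commutator of \<open>A\<close> and \<open>B\<close>. The absence of elliptic elements means
  that the Lorentzian form is semidefinite on the span of \<open>A\<close> and \<open>B\<close>. The commutator is orthogonal to
  this span, hence timelike or null, so that its Hamiltonian is semidefinite. Thus \<open>Q\<close> is monotone along
  all trajectories (\<open>moment_mono_along_solution\<close>), which excludes the group elements that move \<open>Q\<close> in
  the other direction. As the controls are merely measurable, monotonicity rests on
  \<open>abs_continuous_nonneg_derivative_mono\<close>.
\<close>

section \<open>The matrices of SU(1,1) and of its Lie algebra\<close>

text \<open>
  These matrices form a real algebra that contains both the group and its Lie algebra
  (the latter as the members with imaginary \<open>a\<close>), so that all matrix computations reduce to
  formulas in the pair \<open>(a, b)\<close>.
\<close>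
definition cmat :: "complex \<Rightarrow> complex \<Rightarrow> complex^2^2" where
  "cmat a b = mat2 a b (cnj b) (cnj a)"

lemma cmat_nth [simp]:
  "cmat a b $ 1 $ 1 = a" "cmat a b $ 1 $ 2 = b" "cmat a b $ 2 $ 1 = cnj b" "cmat a b $ 2 $ 2 = cnj a"
  by (simp_all add: cmat_def mat2_def)

lemma mat_eq_iff_2: "(M :: 'a^2^2) = N \<longleftrightarrow>
    M $ 1 $ 1 = N $ 1 $ 1 \<and> M $ 1 $ 2 = N $ 1 $ 2 \<and> M $ 2 $ 1 = N $ 2 $ 1 \<and> M $ 2 $ 2 = N $ 2 $ 2"
  by (auto simp: vec_eq_iff forall_2)

lemma cmat_eq_iff [simp]: "cmat a b = cmat c d \<longleftrightarrow> a = c \<and> b = d"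
  by (auto simp: mat_eq_iff_2)

lemma cmat_mult: "cmat a b ** cmat c d = cmat (a * c + b * cnj d) (a * d + b * cnj c)"
  by (simp add: mat_eq_iff_2 matrix_matrix_mult_def sum_2)

lemma cmat_add: "cmat a b + cmat c d = cmat (a + c) (b + d)"
  by (simp add: mat_eq_iff_2)

lemma cmat_scaleR: "r *\<^sub>R cmat a b = cmat (of_real r * a) (of_real r * b)"
  by (simp add: mat_eq_iff_2 scaleR_conv_of_real[where 'a = complex])

lemma cmat_one: "mat 1 = cmat 1 0"
  by (simp add: mat_eq_iff_2 mat_def)

lemma cmat_zero: "0 = cmat 0 0"
  by (simp add: mat_eq_iff_2)

lemma SU11_iff_cmat: "X \<in> SU11 \<longleftrightarrow> (\<exists>a b. X = cmat a b \<and> (cmod a)\<^sup>2 - (cmod b)\<^sup>2 = 1)"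
  by (auto simp: SU11_def cmat_def)

lemma su11_cmat:
  assumes "M \<in> su11"
  obtains \<alpha> \<beta> where "M = cmat (\<i> * of_real \<alpha>) \<beta>"
proof -
  let ?V = "{cmat (\<i> * of_real \<alpha>) \<beta> |\<alpha> \<beta>. True}"
  have "subspace ?V"
  proof (rule subspaceI)
    show "0 \<in> ?V"
      using cmat_zero by (auto intro!: exI[of _ "0::real"])
    show "x + y \<in> ?V" if "x \<in> ?V" "y \<in> ?V" for x y
    proof -
      from that obtain a b c d where "x = cmat (\<i> * of_real a) b" "y = cmat (\<i> * of_real c) d" by blast
      then have "x + y = cmat (\<i> * of_real (a + c)) (b + d)" by (simp add: cmat_add algebra_simps)
      then show ?thesis by blast
    qed
    show "r *\<^sub>R x \<in> ?V" if "x \<in> ?V" for x r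
    proof -
      from that obtain a b where "x = cmat (\<i> * of_real a) b" by blast
      then have "r *\<^sub>R x = cmat (\<i> * of_real (r * a)) (of_real r * b)"
        by (simp add: cmat_scaleR algebra_simps)
      then show ?thesis by blast
    qed
  qed
  moreover have "Kx = cmat (\<i> * of_real 0) (- \<i> / 2)" "Ky = cmat (\<i> * of_real 0) (- 1 / 2)"
    "Kz = cmat (\<i> * of_real (- 1 / 2)) 0"
    by (simp_all add: Kx_def Ky_def Kz_def mat_eq_iff_2 mat2_def scaleR_conv_of_real[where 'a = complex])
  then have "{Kx, Ky, Kz} \<subseteq> ?V" by blast
  ultimately have "su11 \<subseteq> ?V"
    unfolding su11_def by (simp add: span_minimal)
  with assms that show thesis by blast
qed

text \<open>
  For \<open>M = cmat (\<i> \<alpha>) b\<close>, \<open>2 Tr(M\<^sup>2) = 4 (\<bar>b\<bar>\<^sup>2 - \<alpha>\<^sup>2)\<close>, so \<open>Omega\<close> collects the control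
  values for which \<open>A + u B\<close> is elliptic, that is, has nonreal eigenvalues.
\<close>
lemma Omega_cmat_iff:
  "u \<in> Omega (cmat (\<i> * of_real a) b) (cmat (\<i> * of_real \<alpha>) \<beta>) \<longleftrightarrow>
     (cmod (b + of_real u * \<beta>))\<^sup>2 < (a + u * \<alpha>)\<^sup>2"
proof -
  let ?A = "cmat (\<i> * of_real a) b" and ?B = "cmat (\<i> * of_real \<alpha>) \<beta>"
  let ?M = "cmat (\<i> * of_real (a + u * \<alpha>)) (b + of_real u * \<beta>)"
  have M: "?A + u *\<^sub>R ?B = ?M"
    by (simp add: cmat_add cmat_scaleR algebra_simps)
  have "dagger (dagger ?A + u *\<^sub>R dagger ?B) = ?A + u *\<^sub>R ?B"
    by (simp add: mat_eq_iff_2 dagger_def scaleR_conv_of_real[where 'a = complex])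
  then have "trace_form (?A + u *\<^sub>R ?B) (dagger ?A + u *\<^sub>R dagger ?B) = 2 * trace (?M ** ?M)"
    by (simp add: trace_form_def M)
  also have "\<dots> = of_real (4 * ((cmod (b + of_real u * \<beta>))\<^sup>2 - (a + u * \<alpha>)\<^sup>2))"
    unfolding cmat_mult trace_def sum_2 cmat_nth complex_cnj_add complex_cnj_mult complex_cnj_cnj
    by (simp add: complex_eq_iff cmod_power2) (simp add: power2_eq_square algebra_simps)
  finally show ?thesis
    by (simp add: Omega_def less_complex_def)
qed

section \<open>Absolutely continuous functions\<close>

lemma division_of_real_memE:
  fixes k :: "real set"
  assumes "d division_of S" "k \<in> d"
  obtains p q where "k = {p..q}" "p \<le> q" "{p..q} \<subseteq> S"
proof -
  have "k \<subseteq> S" "k \<noteq> {}" "\<exists>p q. k = cbox p q"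
    using division_ofD(2-4)[OF assms] by auto
  then show thesis using that by auto
qed

lemma abs_continuous_imp_continuous_on:
  fixes f :: "real \<Rightarrow> 'a::real_normed_vector"
  assumes "abs_continuous_on {a..b} f"
  shows "continuous_on {a..b} f"
  unfolding continuous_on_iff
proof (intro ballI allI impI)
  fix x e assume x: "x \<in> {a..b}" and "(e::real) > 0"
  with assms obtain d where d: "d > 0"
    "\<And>D. D division_of \<Union>D \<and> \<Union>D \<subseteq> {a..b} \<and> (\<Sum>k\<in>D. Sup k - Inf k) < d \<Longrightarrow>
        (\<Sum>k\<in>D. norm (f (Sup k) - f (Inf k))) < e"
    unfolding abs_continuous_on_def by meson
  have "dist (f y) (f x) < e" if "y \<in> {a..b}" "dist y x < d" for y
  proof -
    let ?k = "cbox (min x y) (max x y)"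
    have "{?k} division_of ?k"
      by (rule division_of_self) (simp add: box_ne_empty)
    then have "norm (f (max x y) - f (min x y)) < e"
      using d(2)[of "{?k}"] that x by (auto simp: dist_real_def max_def min_def split: if_splits)
    then show ?thesis
      by (auto simp: max_def min_def dist_norm norm_minus_commute split: if_splits)
  qed
  with d(1) show "\<exists>d>0. \<forall>x'\<in>{a..b}. dist x' x < d \<longrightarrow> dist (f x') (f x) < e"
    by blast
qed

lemma abs_continuous_on_lipschitz_compose:
  assumes f: "abs_continuous_on S f"
    and g: "\<And>s t. s \<in> S \<Longrightarrow> t \<in> S \<Longrightarrow> norm (g s - g t) \<le> L * norm (f s - f t)"
    and L: "L > 0"
  shows "abs_continuous_on S g"
  unfolding abs_continuous_on_def
proof (intro allI impI)
  fix e :: real assume "e > 0"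
  with L have "e / L > 0" by simp
  with f obtain d where d: "d > 0"
    "\<And>D. D division_of \<Union>D \<and> \<Union>D \<subseteq> S \<and> (\<Sum>k\<in>D. Sup k - Inf k) < d \<Longrightarrow>
        (\<Sum>k\<in>D. norm (f (Sup k) - f (Inf k))) < e / L"
    unfolding abs_continuous_on_def by meson
  have "(\<Sum>k\<in>D. norm (g (Sup k) - g (Inf k))) < e"
    if D: "D division_of \<Union>D \<and> \<Union>D \<subseteq> S \<and> (\<Sum>k\<in>D. Sup k - Inf k) < d" for D
  proof -
    have "norm (g (Sup k) - g (Inf k)) \<le> L * norm (f (Sup k) - f (Inf k))" if "k \<in> D" for k
    proof -
      from D that obtain p q where "k = {p..q}" "p \<le> q" "{p..q} \<subseteq> S"
        by (meson division_of_real_memE order_trans)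
      then have "Sup k \<in> S" "Inf k \<in> S" by auto
      then show ?thesis by (rule g)
    qed
    then have "(\<Sum>k\<in>D. norm (g (Sup k) - g (Inf k))) \<le> (\<Sum>k\<in>D. L * norm (f (Sup k) - f (Inf k)))"
      by (rule sum_mono)
    also have "\<dots> = L * (\<Sum>k\<in>D. norm (f (Sup k) - f (Inf k)))"
      by (simp add: sum_distrib_left)
    also have "\<dots> < e"
      using d(2)[OF D] L by (simp add: field_simps)
    finally show ?thesis .
  qed
  with d(1) show "\<exists>\<delta>>0. \<forall>d. d division_of \<Union>d \<and> \<Union>d \<subseteq> S \<and> (\<Sum>k\<in>d. Sup k - Inf k) < \<delta> \<longrightarrow>
        (\<Sum>k\<in>d. norm (g (Sup k) - g (Inf k))) < e"
    by blast
qed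

lemma lipschitz_imp_abs_continuous_on:
  assumes "L-lipschitz_on S f"
  shows "abs_continuous_on S f"
proof (rule abs_continuous_on_lipschitz_compose)
  show "abs_continuous_on S (\<lambda>t. t)"
    unfolding abs_continuous_on_def
  proof (intro allI impI exI conjI)
    fix e :: real and d assume "e > 0" and d: "d division_of \<Union>d \<and> \<Union>d \<subseteq> S \<and> (\<Sum>k\<in>d. Sup k - Inf k) < e"
    have "norm (Sup k - Inf k) = Sup k - Inf k" if "k \<in> d" for k
    proof -
      from d that obtain p q where "k = {p..q}" "p \<le> q"
        by (meson division_of_real_memE)
      then show ?thesis by auto
    qed
    with d show "(\<Sum>k\<in>d. norm (Sup k - Inf k)) < e" by simp
  qed
  show "norm (f s - f t) \<le> (L + 1) * norm (s - t)" if "s \<in> S" "t \<in> S" for s t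
  proof -
    have "norm (f s - f t) \<le> L * norm (s - t)"
      using lipschitz_onD[OF assms that] by (simp add: dist_norm)
    also have "\<dots> \<le> (L + 1) * norm (s - t)" by (simp add: mult_right_mono)
    finally show ?thesis .
  qed
  show "L + 1 > 0" using lipschitz_on_nonneg[OF assms] by simp
qed

text \<open>
  Lebesgue's theorem in the form needed for Caratheodory solutions, by a gauge argument. Around an
  exceptional point the gauge keeps the interval inside an open set of small measure, and absolute
  continuity makes the total contribution of those intervals small; around any other point the
  derivative shows that the increment is at least \<open>- \<epsilon>\<close> times the length.
\<close>
lemma abs_continuous_nonneg_derivative_mono:
  fixes f :: "real \<Rightarrow> real"
  assumes "a \<le> b" and ac: "abs_continuous_on {a..b} f" and N: "negligible N"
    and deriv: "\<And>t. t \<in> {a..b} - N \<Longrightarrow>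
      \<exists>D\<ge>0. (f has_vector_derivative D) (at t within {a..b})"
  shows "f a \<le> f b"
proof (rule field_le_epsilon)
  fix e :: real assume "e > 0"
  \<comment> \<open>The ordinary tags will cost \<open>\<epsilon> (b - a)\<close> and the exceptional ones \<open>\<epsilon>\<close>.\<close>
  define \<epsilon> where "\<epsilon> = e / (b - a + 1)"
  have \<epsilon>: "\<epsilon> > 0" using \<open>e > 0\<close> \<open>a \<le> b\<close> by (simp add: \<epsilon>_def)
  obtain d where d: "d > 0"
    "\<And>D. D division_of \<Union>D \<and> \<Union>D \<subseteq> {a..b} \<and> (\<Sum>k\<in>D. Sup k - Inf k) < d \<Longrightarrow>
        (\<Sum>k\<in>D. norm (f (Sup k) - f (Inf k))) < \<epsilon>"
    using ac \<epsilon> unfolding abs_continuous_on_def by meson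
  obtain U where U: "open U" "N \<subseteq> U" "U \<in> lmeasurable" "measure lebesgue U < d"
  proof -
    have N': "N \<in> null_sets lebesgue" using N by (simp add: negligible_iff_null_sets)
    obtain U where U: "open U" "N \<subseteq> U" "U - N \<in> lmeasurable" "emeasure lebesgue (U - N) < ennreal d"
      using sets_lebesgue_outer_open[OF null_setsD2[OF N'] \<open>d > 0\<close>] .
    have "U \<in> sets lebesgue" using U(1) by auto
    with N' have eq: "emeasure lebesgue (U - N) = emeasure lebesgue U"
      by (rule emeasure_Diff_null_set)
    then have "emeasure lebesgue U < ennreal d" using U(4) by simp
    moreover from this have "U \<in> lmeasurable"
      using \<open>U \<in> sets lebesgue\<close> order_less_trans[OF _ ennreal_less_top] by (intro fmeasurableI) auto
    ultimately have "measure lebesgue U < d"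
      by (simp add: emeasure_eq_measure2 ennreal_less_iff)
    with \<open>U \<in> lmeasurable\<close> U show thesis using that by blast
  qed
  have "\<exists>r>0. (t \<in> N \<longrightarrow> ball t r \<subseteq> U) \<and> (t \<in> {a..b} - N \<longrightarrow>
      (\<exists>D\<ge>0. \<forall>y\<in>{a..b}. \<bar>y - t\<bar> < r \<longrightarrow> \<bar>f y - f t - (y - t) * D\<bar> \<le> \<epsilon> * \<bar>y - t\<bar>))" for t
  proof (cases "t \<in> N")
    case True
    with U show ?thesis using openE by blast
  next
    case False
    show ?thesis
    proof (cases "t \<in> {a..b}")
      case True
      with False deriv obtain D where D: "D \<ge> 0" "(f has_vector_derivative D) (at t within {a..b})" by blast
      then show ?thesis
        using \<epsilon> False unfolding has_vector_derivative_def has_derivative_within_alt by (auto 4 3)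
    qed (use False in \<open>auto intro: exI[of _ 1]\<close>)
  qed
  then obtain r where r: "\<And>t. r t > 0" "\<And>t. t \<in> N \<Longrightarrow> ball t (r t) \<subseteq> U"
    "\<And>t. t \<in> {a..b} - N \<Longrightarrow>
      \<exists>D\<ge>0. \<forall>y\<in>{a..b}. \<bar>y - t\<bar> < r t \<longrightarrow> \<bar>f y - f t - (y - t) * D\<bar> \<le> \<epsilon> * \<bar>y - t\<bar>"
    by metis
  have "gauge (\<lambda>t. ball t (r t))" using r(1) by (auto simp: gauge_def)
  then obtain p where p: "p tagged_division_of {a..b}" "(\<lambda>t. ball t (r t)) fine p"
    using fine_division_exists_real by blast
  have fin: "finite p" using p by blast
  have mem: "\<exists>c d. k = {c..d} \<and> c \<le> x \<and> x \<le> d \<and> x \<in> {a..b} \<and> {c..d} \<subseteq> {a..b} \<and> {c..d} \<subseteq> ball x (r x)"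
    if "(x, k) \<in> p" for x k
  proof -
    have "x \<in> k" "k \<subseteq> {a..b}" "\<exists>a b. k = cbox a b"
      using tagged_division_ofD[OF p(1)] that by blast+
    moreover have "k \<subseteq> ball x (r x)" using p(2) that by (auto simp: fine_def)
    ultimately show ?thesis by (fastforce simp: subset_iff)
  qed
  define q where "q = {(x, k) \<in> p. x \<in> N}"
  have q: "q tagged_division_of \<Union>(snd ` q)"
    by (rule tagged_partial_division_of_Union_self, rule tagged_partial_division_subset)
       (use p in \<open>auto simp: q_def tagged_division_of_def\<close>)
  let ?v = "\<lambda>k. f (Sup k) - f (Inf k)"
  have q_sum: "\<bar>\<Sum>(x, k)\<in>q. ?v k\<bar> \<le> \<epsilon>"
  proof -
    \<comment> \<open>Passing from tagged intervals to the set of intervals merges degenerate ones only. The case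
      distinction is there because \<open>Sup {}\<close> and \<open>Inf {}\<close> have no known value.\<close>
    let ?w = "\<lambda>k. if k = {} then 0 else \<bar>?v k\<bar>"
    have ne: "k \<noteq> {}" if "(x, k) \<in> q" for x k
      using mem[of x k] that by (auto simp: q_def)
    have div: "snd ` q division_of \<Union>(snd ` q)"
      using q by (rule division_of_tagged_division)
    have sub: "\<Union>(snd ` q) \<subseteq> {a..b}" "\<Union>(snd ` q) \<subseteq> U"
      using mem r(2) by (fastforce simp: q_def)+
    have "(\<Sum>k\<in>snd ` q. Sup k - Inf k) = (\<Sum>k\<in>snd ` q. measure lebesgue k)"
    proof (rule sum.cong)
      fix k assume "k \<in> snd ` q"
      with div obtain c d where "k = {c..d}" "c \<le> d" by (rule division_of_real_memE)
      then show "Sup k - Inf k = measure lebesgue k" by simp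
    qed simp
    also have "\<dots> = measure lebesgue (\<Union>(snd ` q))"
      using div by (rule content_division)
    also have "\<dots> \<le> measure lebesgue U"
      using sub(2) lmeasurable_division[OF div] U(3) by (intro measure_mono_fmeasurable) auto
    also have "\<dots> < d" by fact
    finally have small: "(\<Sum>k\<in>snd ` q. \<bar>?v k\<bar>) < \<epsilon>"
      using d(2)[of "snd ` q"] div sub(1) by simp
    have "\<bar>\<Sum>(x, k)\<in>q. ?v k\<bar> \<le> (\<Sum>(x, k)\<in>q. \<bar>?v k\<bar>)"
      by (rule order_trans[OF sum_abs]) (simp add: case_prod_unfold)
    also have "\<dots> = (\<Sum>(x, k)\<in>q. ?w k)"
      by (rule sum.cong) (use ne in auto)
    also have "\<dots> = sum ?w (snd ` q)"
    proof (rule sum.over_tagged_division_lemma[OF q])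
      fix u v :: real assume "box u v = {}"
      then have "cbox u v = {} \<or> u = v" by auto
      then show "?w (cbox u v) = 0" by auto
    qed
    also have "\<dots> = (\<Sum>k\<in>snd ` q. \<bar>?v k\<bar>)"
      by (rule sum.cong) (use ne in auto)
    finally show ?thesis using small by linarith
  qed
  have rest: "?v k \<ge> - \<epsilon> * (Sup k - Inf k)" if xk: "(x, k) \<in> p - q" for x k
  proof -
    obtain c d where k: "k = {c..d}" "c \<le> x" "x \<le> d" "x \<in> {a..b}"
      "{c..d} \<subseteq> {a..b}" "{c..d} \<subseteq> ball x (r x)"
      using mem xk by blast
    have "x \<notin> N" using xk by (auto simp: q_def)
    with r(3) k obtain D where D: "D \<ge> 0"
      "\<And>y. y \<in> {a..b} \<Longrightarrow> \<bar>y - x\<bar> < r x \<Longrightarrow> \<bar>f y - f x - (y - x) * D\<bar> \<le> \<epsilon> * \<bar>y - x\<bar>"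
      by blast
    have cd: "c \<in> {c..d}" "d \<in> {c..d}" using k by auto
    have "\<bar>c - x\<bar> < r x" "\<bar>d - x\<bar> < r x" "c \<in> {a..b}" "d \<in> {a..b}"
      using k(5,6) cd by (auto simp: subset_iff dist_real_def abs_minus_commute)
    with D(2)[of c] D(2)[of d] k
    have "\<bar>f c - f x - (c - x) * D\<bar> \<le> \<epsilon> * (x - c)" "\<bar>f d - f x - (d - x) * D\<bar> \<le> \<epsilon> * (d - x)"
      by auto
    then have "f d - f c \<ge> (d - x) * D + (x - c) * D - \<epsilon> * (x - c) - \<epsilon> * (d - x)"
      by (simp add: abs_le_iff algebra_simps)
    moreover have "(d - x) * D \<ge> 0" "(x - c) * D \<ge> 0" using D k by auto
    ultimately have "f d - f c \<ge> - \<epsilon> * (d - c)" by (simp add: algebra_simps)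
    then show ?thesis using k by simp
  qed
  have "f b - f a = (\<Sum>(x, k)\<in>p. ?v k)"
    using additive_tagged_division_1[OF \<open>a \<le> b\<close> p(1), of f] by simp
  also have "\<dots> = (\<Sum>(x, k)\<in>p - q. ?v k) + (\<Sum>(x, k)\<in>q. ?v k)"
    by (rule sum.subset_diff) (use fin in \<open>auto simp: q_def\<close>)
  also have "\<dots> \<ge> - \<epsilon> * (b - a) - \<epsilon>"
  proof -
    have "(\<Sum>(x, k)\<in>p - q. \<epsilon> * (Sup k - Inf k)) \<le> (\<Sum>(x, k)\<in>p. \<epsilon> * (Sup k - Inf k))"
    proof (rule sum_mono2)
      fix z assume "z \<in> p - (p - q)"
      then obtain x k where "z = (x, k)" "(x, k) \<in> p" by (cases z) auto
      with mem[of x k] \<epsilon> show "0 \<le> (case z of (x, k) \<Rightarrow> \<epsilon> * (Sup k - Inf k))" by auto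
    qed (use fin in auto)
    also have "\<dots> = \<epsilon> * (b - a)"
      using additive_tagged_division_1[OF \<open>a \<le> b\<close> p(1), of "\<lambda>x. \<epsilon> * x"]
      by (simp add: algebra_simps)
    finally have "(\<Sum>(x, k)\<in>p - q. - \<epsilon> * (Sup k - Inf k)) \<ge> - \<epsilon> * (b - a)"
      by (simp add: case_prod_unfold sum_negf)
    moreover have "(\<Sum>(x, k)\<in>p - q. ?v k) \<ge> (\<Sum>(x, k)\<in>p - q. - \<epsilon> * (Sup k - Inf k))"
      by (rule sum_mono) (use rest in auto)
    ultimately show ?thesis using q_sum by linarith
  qed
  finally have "f b - f a \<ge> - \<epsilon> * (b - a) - \<epsilon>" .
  moreover have "\<epsilon> * (b - a) + \<epsilon> = e"
    using \<open>a \<le> b\<close> by (simp add: \<epsilon>_def divide_simps) (simp add: algebra_simps)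
  ultimately show "f a \<le> f b + e" by linarith
qed

section \<open>A monotone quantity when Omega is empty\<close>

lemma nonneg_quadratic_imp_discriminant_le:
  fixes c d e :: real
  assumes nonneg: "\<And>u. c * u\<^sup>2 + 2 * e * u + d \<ge> 0"
  shows "e\<^sup>2 \<le> c * d"
proof (cases "c = 0")
  case True
  have "e = 0"
  proof (rule ccontr)
    assume "e \<noteq> 0"
    with nonneg[of "- (d + 1) / (2 * e)"] True show False by simp
  qed
  with True show ?thesis by simp
next
  case False
  have "c * (- e / c)\<^sup>2 + 2 * e * (- e / c) + d = (c * d - e\<^sup>2) / c"
    using False by (simp add: power2_eq_square field_simps)
  with nonneg[of "- e / c"] have *: "(c * d - e\<^sup>2) / c \<ge> 0" by simp
  have "c > 0"
  proof (rule ccontr)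
    assume "\<not> c > 0"
    with False have "c < 0" by simp
    define u where "u = (2 * \<bar>e\<bar> + \<bar>d\<bar> + 1) / \<bar>c\<bar> + 1"
    have u: "u \<ge> 1" by (simp add: u_def)
    have cu: "c * u = - (2 * \<bar>e\<bar> + \<bar>d\<bar> + 1) + c"
      using \<open>c < 0\<close> by (simp add: u_def field_simps)
    have "c * u\<^sup>2 + 2 * e * u + d \<le> (c * u + 2 * \<bar>e\<bar> + \<bar>d\<bar>) * u"
    proof -
      have "2 * e * u \<le> 2 * \<bar>e\<bar> * u" using u by (simp add: mult_right_mono)
      moreover have "\<bar>d\<bar> * 1 \<le> \<bar>d\<bar> * u" using u by (intro mult_left_mono) auto
      ultimately show ?thesis by (simp add: power2_eq_square algebra_simps)
    qed
    also have "\<dots> = (c - 1) * u" using cu by simp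
    also have "\<dots> < 0" using u \<open>c < 0\<close> by (simp add: mult_neg_pos)
    finally show False using nonneg[of u] by simp
  qed
  with * show ?thesis by (simp add: zero_le_divide_iff)
qed

text \<open>
  The group and its Lie algebra preserve the real form \<open>{(z, cnj z)}\<close> of the vector space
  \<open>\<complex>\<^sup>2\<close>. The image of \<open>(z, cnj z)\<close> under \<open>Y\<close> is projected onto it along its multiple by \<open>\<i>\<close>.
  This projection commutes with the Lie algebra, so that it turns every matrix solution into a
  solution of the planar equation \<open>\<zeta>' = \<i> a \<zeta> + b cnj \<zeta>\<close>, without first showing that the solution
  stays inside the group.
\<close>
definition real_part_action :: "complex \<Rightarrow> complex^2^2 \<Rightarrow> complex" where
  "real_part_action z Y = ((Y $ 1 $ 1 * z + Y $ 1 $ 2 * cnj z) + cnj (Y $ 2 $ 1 * z + Y $ 2 $ 2 * cnj z)) / 2"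

lemma real_part_action_cmat: "real_part_action z (cmat a b) = a * z + b * cnj z"
  by (simp add: real_part_action_def)

lemma real_part_action_mult:
  "real_part_action z (cmat a b ** Y) = a * real_part_action z Y + b * cnj (real_part_action z Y)"
  by (simp add: real_part_action_def matrix_matrix_mult_def sum_2 field_simps)

lemma bounded_linear_real_part_action: "bounded_linear (real_part_action z)"
proof -
  have "linear (real_part_action z)"
    by (rule linearI) (simp_all add: real_part_action_def scaleR_conv_of_real[where 'a = complex] field_simps)
  then show ?thesis by (simp add: linear_conv_bounded_linear)
qed

text \<open>
  The Hamiltonian (moment map) of the linear vector field \<open>z \<mapsto> \<i> \<alpha> z + \<beta> cnj z\<close> with respect to
  the area form: it equals \<open>Im (cnj z * (\<i> \<alpha> z + \<beta> cnj z))\<close>. The flow of the field conserves it.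
\<close>
definition moment :: "real \<Rightarrow> complex \<Rightarrow> complex \<Rightarrow> real" where
  "moment \<alpha> \<beta> z = \<alpha> * Re (z * cnj z) + Im (\<beta> * (cnj z * cnj z))"

lemma moment_diff_le:
  "\<bar>moment \<alpha> \<beta> z - moment \<alpha> \<beta> w\<bar> \<le> (\<bar>\<alpha>\<bar> + cmod \<beta>) * (cmod z + cmod w) * cmod (z - w)"
proof -
  have factor: "(cmod z - cmod w) * (cmod z + cmod w) = (Re z)\<^sup>2 + (Im z)\<^sup>2 - ((Re w)\<^sup>2 + (Im w)\<^sup>2)"
    unfolding cmod_power2[symmetric] by (simp add: power2_eq_square algebra_simps)
  have "moment \<alpha> \<beta> z - moment \<alpha> \<beta> w =
      \<alpha> * ((cmod z - cmod w) * (cmod z + cmod w)) + Im (\<beta> * (cnj (z - w) * cnj (z + w)))"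
    unfolding factor
    by (simp add: moment_def) (simp add: power2_eq_square algebra_simps)
  also have "\<bar>\<dots>\<bar> \<le> \<bar>\<alpha>\<bar> * (cmod (z - w) * (cmod z + cmod w)) + cmod \<beta> * (cmod (z - w) * (cmod z + cmod w))"
  proof (rule order_trans[OF abs_triangle_ineq add_mono])
    show "\<bar>\<alpha> * ((cmod z - cmod w) * (cmod z + cmod w))\<bar> \<le> \<bar>\<alpha>\<bar> * (cmod (z - w) * (cmod z + cmod w))"
      unfolding abs_mult by (intro mult_left_mono mult_mono) (auto simp: norm_triangle_ineq3)
    have "\<bar>Im (\<beta> * (cnj (z - w) * cnj (z + w)))\<bar> \<le> cmod (\<beta> * (cnj (z - w) * cnj (z + w)))"
      by (rule abs_Im_le_cmod)
    also have "\<dots> = cmod \<beta> * (cmod (z - w) * cmod (z + w))"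
      unfolding norm_mult complex_mod_cnj ..
    also have "\<dots> \<le> cmod \<beta> * (cmod (z - w) * (cmod z + cmod w))"
      by (intro mult_left_mono norm_triangle_ineq) auto
    finally show "\<bar>Im (\<beta> * (cnj (z - w) * cnj (z + w)))\<bar> \<le> cmod \<beta> * (cmod (z - w) * (cmod z + cmod w))" .
  qed
  finally show ?thesis by (simp add: algebra_simps)
qed

text \<open>
  The control value has no influence on the derivative because the flow of \<open>B\<close> conserves the
  Hamiltonian of \<open>B\<close>. What remains is, up to a constant factor, the Hamiltonian of the commutator of
  \<open>A\<close> and \<open>B\<close>, again a quadratic form.
\<close>
lemma moment_derivative:
  assumes "(\<zeta> has_vector_derivative (\<i> * of_real (a + u * \<alpha>)) * \<zeta> t + (b + of_real u * \<beta>) * cnj (\<zeta> t)) (at t within S)"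
  shows "((\<lambda>t. moment \<alpha> \<beta> (\<zeta> t)) has_vector_derivative
     2 * Im (\<beta> * cnj b) * (cmod (\<zeta> t))\<^sup>2 + 2 * Re ((of_real \<alpha> * b - of_real a * \<beta>) * (cnj (\<zeta> t))\<^sup>2)) (at t within S)"
proof -
  define w where "w = (\<i> * of_real (a + u * \<alpha>)) * \<zeta> t + (b + of_real u * \<beta>) * cnj (\<zeta> t)"
  have z: "(\<zeta> has_vector_derivative w) (at t within S)" using assms by (simp add: w_def)
  have zc: "((\<lambda>t. cnj (\<zeta> t)) has_vector_derivative cnj w) (at t within S)"
    using z by (rule has_vector_derivative_cnj)
  have "((\<lambda>t. \<alpha> *\<^sub>R Re (\<zeta> t * cnj (\<zeta> t)) + Im (\<beta> * (cnj (\<zeta> t) * cnj (\<zeta> t)))) has_vector_derivative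
      \<alpha> *\<^sub>R Re (\<zeta> t * cnj w + w * cnj (\<zeta> t)) + Im (\<beta> * (cnj (\<zeta> t) * cnj w + cnj w * cnj (\<zeta> t))))
      (at t within S)"
    by (intro has_vector_derivative_add bounded_linear.has_vector_derivative[OF bounded_linear_scaleR_right]
        bounded_linear.has_vector_derivative[OF bounded_linear_Re]
        bounded_linear.has_vector_derivative[OF bounded_linear_Im]
        bounded_linear.has_vector_derivative[OF bounded_linear_mult_right]
        has_vector_derivative_mult z zc)
  moreover have "\<alpha> *\<^sub>R Re (\<zeta> t * cnj w + w * cnj (\<zeta> t)) + Im (\<beta> * (cnj (\<zeta> t) * cnj w + cnj w * cnj (\<zeta> t)))
     = 2 * Im (\<beta> * cnj b) * (cmod (\<zeta> t))\<^sup>2 + 2 * Re ((of_real \<alpha> * b - of_real a * \<beta>) * (cnj (\<zeta> t))\<^sup>2)"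
    unfolding cmod_power2 w_def by (simp add: power2_eq_square) algebra
  ultimately show ?thesis by (simp add: moment_def)
qed

text \<open>
  The hypothesis on \<open>\<sigma>\<close> says that the quadratic form in the derivative is semidefinite with sign
  \<open>\<sigma>\<close>.
\<close>
lemma moment_mono_along_solution:
  fixes \<sigma> :: real
  assumes sol: "is_solution (cmat (\<i> * of_real a) b) (cmat (\<i> * of_real \<alpha>) \<beta>) u X"
    and "T \<ge> 0" and \<sigma>: "\<bar>\<sigma>\<bar> = 1"
    and semidef: "cmod (of_real \<alpha> * b - of_real a * \<beta>) \<le> \<sigma> * Im (\<beta> * cnj b)"
  shows "\<sigma> * moment \<alpha> \<beta> z \<le> \<sigma> * moment \<alpha> \<beta> (real_part_action z (X T))"
proof -
  let ?A = "cmat (\<i> * of_real a) b" and ?B = "cmat (\<i> * of_real \<alpha>) \<beta>"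
  define \<zeta> where "\<zeta> t = real_part_action z (X t)" for t
  define f where "f t = \<sigma> * moment \<alpha> \<beta> (\<zeta> t)" for t
  have X0: "X 0 = mat 1" and acX: "abs_continuous_on {0..T} X"
    using sol \<open>T \<ge> 0\<close> by (auto simp: is_solution_def)
  obtain N where N: "N \<in> null_sets (lebesgue_on {0..})"
    "\<And>t. t \<in> {0..} \<Longrightarrow> t \<notin> N \<Longrightarrow> (X has_vector_derivative ((?A + u t *\<^sub>R ?B) ** X t)) (at t within {0..})"
  proof -
    have "AE t in lebesgue_on {0..}.
        (X has_vector_derivative ((?A + u t *\<^sub>R ?B) ** X t)) (at t within {0..})"
      using sol by (simp add: is_solution_def)
    then show thesis using that by (auto simp: eventually_ae_filter)
  qed
  have "negligible N"
    using N(1) by (simp add: negligible_iff_null_sets null_sets_restrict_space)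
  have deriv: "\<exists>D\<ge>0. (f has_vector_derivative D) (at t within {0..T})" if t: "t \<in> {0..T} - N" for t
  proof -
    let ?M = "cmat (\<i> * of_real (a + u t * \<alpha>)) (b + of_real (u t) * \<beta>)"
    have M: "?A + u t *\<^sub>R ?B = ?M" by (simp add: cmat_add cmat_scaleR algebra_simps)
    have "(X has_vector_derivative (?M ** X t)) (at t within {0..T})"
      using N(2)[of t] t unfolding M by (auto intro: has_vector_derivative_within_subset)
    from bounded_linear.has_vector_derivative[OF bounded_linear_real_part_action this]
    have "(\<zeta> has_vector_derivative real_part_action z (?M ** X t)) (at t within {0..T})"
      by (simp add: \<zeta>_def[abs_def])
    then have "(\<zeta> has_vector_derivative (\<i> * of_real (a + u t * \<alpha>)) * \<zeta> t + (b + of_real (u t) * \<beta>) * cnj (\<zeta> t))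
      (at t within {0..T})"
      by (simp only: real_part_action_mult \<zeta>_def)
    note D = moment_derivative[OF this]
    let ?c = "of_real \<alpha> * b - of_real a * \<beta>"
    let ?D = "2 * Im (\<beta> * cnj b) * (cmod (\<zeta> t))\<^sup>2 + 2 * Re (?c * (cnj (\<zeta> t))\<^sup>2)"
    have "(f has_vector_derivative \<sigma> * ?D) (at t within {0..T})"
      unfolding f_def[abs_def] by (rule bounded_linear.has_vector_derivative[OF bounded_linear_mult_right D])
    moreover have "\<sigma> * ?D \<ge> 0"
    proof -
      have "\<bar>\<sigma> * Re (?c * (cnj (\<zeta> t))\<^sup>2)\<bar> \<le> cmod (?c * (cnj (\<zeta> t))\<^sup>2)"
        by (simp only: abs_mult \<sigma> mult_1 abs_Re_le_cmod)
      also have "\<dots> = cmod ?c * (cmod (\<zeta> t))\<^sup>2" by (simp add: norm_mult norm_power)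
      also have "\<dots> \<le> (\<sigma> * Im (\<beta> * cnj b)) * (cmod (\<zeta> t))\<^sup>2"
        by (intro mult_right_mono semidef) auto
      finally show ?thesis by (simp add: algebra_simps)
    qed
    ultimately show ?thesis by blast
  qed
  have "abs_continuous_on {0..T} f"
  proof -
    obtain K where K: "K > 0" "\<And>Y. cmod (real_part_action z Y) \<le> norm Y * K"
      using bounded_linear.pos_bounded[OF bounded_linear_real_part_action] by blast
    have "continuous_on {0..T} X" using acX by (rule abs_continuous_imp_continuous_on)
    then have "bounded (X ` {0..T})" by (intro compact_imp_bounded compact_continuous_image) auto
    then obtain R where R: "R > 0" "\<And>t. t \<in> {0..T} \<Longrightarrow> norm (X t) \<le> R"
      by (auto simp: bounded_pos)
    let ?m = "\<bar>\<alpha>\<bar> + cmod \<beta>"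
    show ?thesis
    proof (rule abs_continuous_on_lipschitz_compose[OF acX])
      fix s t assume st: "s \<in> {0..T}" "t \<in> {0..T}"
      have bd: "cmod (\<zeta> r) \<le> R * K" if "r \<in> {0..T}" for r
        unfolding \<zeta>_def
        by (rule order_trans[OF K(2) mult_right_mono[OF R(2)[OF that]]]) (use K(1) in simp)
      have "cmod (\<zeta> s - \<zeta> t) \<le> norm (X s - X t) * K"
        using K(2)[of "X s - X t"]
        by (simp add: \<zeta>_def linear_diff[OF bounded_linear.linear[OF bounded_linear_real_part_action]])
      then have "?m * (cmod (\<zeta> s) + cmod (\<zeta> t)) * cmod (\<zeta> s - \<zeta> t) \<le> ?m * (R * K + R * K) * (norm (X s - X t) * K)"
        by (intro mult_mono'[OF mult_left_mono[OF add_mono[OF bd[OF st(1)] bd[OF st(2)]]]]) simp_all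
      then have "norm (f s - f t) \<le> ?m * (R * K + R * K) * (norm (X s - X t) * K)"
        using moment_diff_le[of \<alpha> \<beta> "\<zeta> s" "\<zeta> t"] \<sigma>
        by (simp add: f_def right_diff_distrib[symmetric] abs_mult)
      also have "\<dots> = (?m * (2 * R * K * K)) * norm (X s - X t)" by (simp add: algebra_simps)
      also have "\<dots> \<le> (?m * (2 * R * K * K) + 1) * norm (X s - X t)" by (intro mult_right_mono) auto
      finally show "norm (f s - f t) \<le> (?m * (2 * R * K * K) + 1) * norm (X s - X t)" .
    next
      show "?m * (2 * R * K * K) + 1 > 0"
        using R(1) K(1) by (intro add_nonneg_pos mult_nonneg_nonneg) auto
    qed
  qed
  then have "f 0 \<le> f T"
    by (rule abs_continuous_nonneg_derivative_mono[OF \<open>T \<ge> 0\<close> _ \<open>negligible N\<close> deriv])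
  then show ?thesis
    by (simp add: f_def \<zeta>_def X0 cmat_one real_part_action_cmat)
qed

lemma moment_nonzero:
  assumes "cmat (\<i> * of_real \<alpha>) \<beta> \<noteq> 0"
  obtains z where "z \<noteq> 0" "moment \<alpha> \<beta> z \<noteq> 0"
proof -
  have "moment \<alpha> \<beta> 1 = \<alpha> + Im \<beta>" "moment \<alpha> \<beta> \<i> = \<alpha> - Im \<beta>"
    "moment \<alpha> \<beta> (1 + \<i>) = 2 * \<alpha> - 2 * Re \<beta>"
    by (simp_all add: moment_def)
  moreover have "\<not> (\<alpha> = 0 \<and> Re \<beta> = 0 \<and> Im \<beta> = 0)"
    using assms by (auto simp: cmat_zero complex_eq_iff)
  ultimately have "moment \<alpha> \<beta> 1 \<noteq> 0 \<or> moment \<alpha> \<beta> \<i> \<noteq> 0 \<or> moment \<alpha> \<beta> (1 + \<i>) \<noteq> 0" by auto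
  moreover have "1 + \<i> \<noteq> 0" by (simp add: complex_eq_iff)
  ultimately show thesis using that[of 1] that[of \<i>] that[of "1 + \<i>"] by auto
qed

text \<open>
  SU(1,1) acts on the plane as SL(2,R), hence contains elements that stretch a given direction.
\<close>
lemma SU11_scales_vector:
  fixes l :: real
  assumes "z \<noteq> 0" "l \<noteq> 0"
  obtains a b where "cmat a b \<in> SU11" "a * z + b * cnj z = of_real l * z"
proof
  \<comment> \<open>The stretch by \<open>l\<close> along \<open>z\<close> and by \<open>1 / l\<close> across it.\<close>
  let ?a = "of_real ((l + 1 / l) / 2) :: complex" and ?b = "of_real ((l - 1 / l) / 2) * (z / cnj z)"
  have "(cmod ?a)\<^sup>2 - (cmod ?b)\<^sup>2 = ((l + 1 / l) / 2)\<^sup>2 - ((l - 1 / l) / 2)\<^sup>2"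
    using assms(1) by (simp only: norm_mult norm_divide complex_mod_cnj norm_of_real power_mult_distrib power2_abs) simp
  also have "\<dots> = 1" using assms(2) by (simp add: power2_eq_square field_simps)
  finally show "cmat ?a ?b \<in> SU11" unfolding SU11_iff_cmat by blast
  show "?a * z + ?b * cnj z = of_real l * z"
    using assms by (simp add: field_simps)
qed

text \<open>
  If no \<open>A + u B\<close> is elliptic, the quadratic polynomial in \<open>u\<close> that decides ellipticity has
  nonpositive discriminant. This discriminant inequality is exactly semidefiniteness of the
  derivative of the Hamiltonian of \<open>B\<close>, which is therefore monotone along all trajectories,
  whereas the group can both increase and decrease any nonzero value of it by scaling a vector.
\<close>
lemma controllable_imp_Omega_nonempty:
  assumes A: "A = cmat (\<i> * of_real a) b" and B: "B = cmat (\<i> * of_real \<alpha>) \<beta>"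
    and "B \<noteq> 0" and ctrl: "controllable A B"
  shows "Omega A B \<noteq> {}"
proof
  assume empty: "Omega A B = {}"
  have "0 \<le> ((cmod \<beta>)\<^sup>2 - \<alpha>\<^sup>2) * u\<^sup>2 + 2 * (Re (b * cnj \<beta>) - a * \<alpha>) * u + ((cmod b)\<^sup>2 - a\<^sup>2)" for u
  proof -
    have "u \<notin> Omega A B" using empty by simp
    then have "0 \<le> (cmod (b + of_real u * \<beta>))\<^sup>2 - (a + u * \<alpha>)\<^sup>2"
      by (simp add: A B Omega_cmat_iff)
    also have "\<dots> = ((cmod \<beta>)\<^sup>2 - \<alpha>\<^sup>2) * u\<^sup>2 + 2 * (Re (b * cnj \<beta>) - a * \<alpha>) * u + ((cmod b)\<^sup>2 - a\<^sup>2)"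
      unfolding cmod_power2 by (simp add: power2_eq_square algebra_simps)
    finally show ?thesis .
  qed
  then have "(Re (b * cnj \<beta>) - a * \<alpha>)\<^sup>2 \<le> ((cmod \<beta>)\<^sup>2 - \<alpha>\<^sup>2) * ((cmod b)\<^sup>2 - a\<^sup>2)"
    by (rule nonneg_quadratic_imp_discriminant_le)
  \<comment> \<open>Lagrange's identity for the commutator: \<open>\<bar>b\<bar>\<^sup>2 \<bar>\<beta>\<bar>\<^sup>2 = Re (b cnj \<beta>)\<^sup>2 + Im (b cnj \<beta>)\<^sup>2\<close>.\<close>
  then have "(cmod (of_real \<alpha> * b - of_real a * \<beta>))\<^sup>2 \<le> (Im (\<beta> * cnj b))\<^sup>2"
    unfolding cmod_power2 by (simp add: power2_eq_square algebra_simps)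
  then have le: "cmod (of_real \<alpha> * b - of_real a * \<beta>) \<le> \<bar>Im (\<beta> * cnj b)\<bar>"
    by (simp add: abs_le_square_iff[symmetric])
  define \<sigma> :: real where "\<sigma> = (if Im (\<beta> * cnj b) \<ge> 0 then 1 else - 1)"
  have \<sigma>: "\<bar>\<sigma>\<bar> = 1" "cmod (of_real \<alpha> * b - of_real a * \<beta>) \<le> \<sigma> * Im (\<beta> * cnj b)"
    using le by (auto simp: \<sigma>_def)
  obtain z where z: "z \<noteq> 0" "moment \<alpha> \<beta> z \<noteq> 0"
    using \<open>B \<noteq> 0\<close> moment_nonzero unfolding B by blast
  define l :: real where "l = (if \<sigma> * moment \<alpha> \<beta> z > 0 then 1 / 2 else 2)"
  have "l \<noteq> 0" by (simp add: l_def)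
  with z(1) obtain p q where pq: "cmat p q \<in> SU11" "p * z + q * cnj z = of_real l * z"
    using SU11_scales_vector by blast
  with ctrl obtain T u X where "T \<ge> 0" "is_solution A B u X" "X T = cmat p q"
    unfolding controllable_def reachable_set_def by blast
  then have "\<sigma> * moment \<alpha> \<beta> z \<le> \<sigma> * moment \<alpha> \<beta> (of_real l * z)"
    using moment_mono_along_solution[of a b \<alpha> \<beta> u X T \<sigma> z] \<sigma> pq(2)
    by (simp add: A B real_part_action_cmat)
  also have "moment \<alpha> \<beta> (of_real l * z) = l\<^sup>2 * moment \<alpha> \<beta> z"
    by (simp add: moment_def power2_eq_square algebra_simps)
  finally have "\<sigma> * moment \<alpha> \<beta> z \<le> l\<^sup>2 * (\<sigma> * moment \<alpha> \<beta> z)" by (simp add: algebra_simps)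
  moreover have "\<sigma> * moment \<alpha> \<beta> z \<noteq> 0" using z(2) \<sigma>(1) by auto
  ultimately show False
    by (auto simp: l_def power2_eq_square split: if_splits)
qed

section \<open>Generating SU(1,1) from elliptic one-parameter groups\<close>

definition rot :: "real \<Rightarrow> complex^2^2" where
  "rot \<theta> = cmat (cis \<theta>) 0"

lemma rot_mult_cmat_mult_rot: "rot \<phi> ** cmat a b ** rot \<psi> = cmat (cis (\<phi> + \<psi>) * a) (cis (\<phi> - \<psi>) * b)"
  by (simp add: rot_def cmat_mult cis_cnj diff_conv_add_uminus mult_ac
      flip: cis_mult del: add_uminus_conv_diff)

text \<open>
  The modulus of \<open>b\<close> is a complete invariant of the double cosets of the rotation group.
\<close>
lemma SU11_KAK:
  assumes "cmat a b \<in> SU11" "cmat c d \<in> SU11" "cmod b = cmod d"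
  obtains \<phi> \<psi> where "cmat c d = rot \<phi> ** cmat a b ** rot \<psi>"
proof -
  have unit: "\<exists>s. y = cis s * x" if "cmod x = cmod y" for x y
  proof -
    have "x = of_real (cmod x) * cis (Arg x)" "y = of_real (cmod x) * cis (Arg y)"
      using rcis_cmod_Arg[of x] rcis_cmod_Arg[of y] that by (simp_all add: rcis_def)
    then have "y = cis (Arg y - Arg x) * x"
      by (metis (no_types, lifting) cis_mult diff_add_cancel mult.left_commute)
    then show ?thesis by blast
  qed
  have "(cmod a)\<^sup>2 - (cmod b)\<^sup>2 = 1" "(cmod c)\<^sup>2 - (cmod d)\<^sup>2 = 1"
    using assms(1,2) by (auto simp: SU11_iff_cmat)
  with assms(3) have "(cmod a)\<^sup>2 = (cmod c)\<^sup>2" by (simp only: diff_eq_eq)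
  then have "cmod a = cmod c" by (simp add: power2_eq_iff_nonneg)
  with assms(3) obtain s r where "c = cis s * a" "d = cis r * b" using unit by metis
  then have "cmat c d = rot ((s + r) / 2) ** cmat a b ** rot ((s - r) / 2)"
    by (simp add: rot_mult_cmat_mult_rot add_divide_distrib[symmetric] diff_divide_distrib[symmetric])
  then show thesis by (rule that)
qed

text \<open>
  Membership in \<open>S\<close> depends only on the modulus of \<open>b\<close>. If \<open>h\<close> is the symmetric real
  representative of modulus \<open>s\<close>, the products \<open>h ** rot \<theta> ** h\<close> realise every modulus from 0 to
  \<open>2 s sqrt (1 + s\<^sup>2) \<ge> 2 s\<close>, so the range of available moduli at least doubles each time.
\<close>
lemma rotations_and_one_more_generate_SU11:
  assumes mult: "\<And>X Y. X \<in> S \<Longrightarrow> Y \<in> S \<Longrightarrow> X ** Y \<in> S"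
    and rot: "\<And>\<theta>. rot \<theta> \<in> S"
    and extra: "cmat a b \<in> S" "cmat a b \<in> SU11" "b \<noteq> 0"
  shows "SU11 \<subseteq> S"
proof -
  define Q where "Q s \<longleftrightarrow> (\<forall>c d. cmat c d \<in> SU11 \<and> cmod d = s \<longrightarrow> cmat c d \<in> S)" for s
  have Q_of_mem: "Q (cmod d)" if "cmat c d \<in> S" "cmat c d \<in> SU11" for c d
    unfolding Q_def using that by (metis SU11_KAK mult rot)
  have double: "Q s'" if "Q s" "0 \<le> s'" "s' \<le> 2 * s" for s s'
  proof -
    define c where "c = sqrt (1 + s\<^sup>2)"
    have c: "c\<^sup>2 = 1 + s\<^sup>2" "c \<ge> 1" by (simp_all add: c_def)
    define h where "h = cmat (of_real c) (of_real s)"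
    have s: "s \<ge> 0" using that by linarith
    have h: "h \<in> SU11" using c(1) unfolding h_def SU11_iff_cmat
      by (intro exI[of _ "of_real c"] exI[of _ "of_real s"]) simp
    then have hS: "h \<in> S" using \<open>Q s\<close> s unfolding Q_def h_def by force
    have "s' \<le> 2 * c * s" using that(3) mult_right_mono[OF c(2), of s] s by linarith
    define \<theta> where "\<theta> = arccos (s' / (2 * c * s))"
    have eq: "2 * c * s * cos \<theta> = s'"
    proof (cases "s = 0")
      case True
      with that show ?thesis by simp
    next
      case False
      with s c have "2 * c * s > 0" by simp
      with \<open>s' \<le> 2 * c * s\<close> \<open>0 \<le> s'\<close> have "0 \<le> s' / (2 * c * s)" "s' / (2 * c * s) \<le> 1"
        by (simp_all only: divide_le_eq_1_pos zero_le_divide_iff) auto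
      then have "cos \<theta> = s' / (2 * c * s)" unfolding \<theta>_def by (intro cos_arccos) auto
      moreover have "2 * c * s \<noteq> 0" using \<open>2 * c * s > 0\<close> by linarith
      ultimately show ?thesis by (metis nonzero_eq_divide_eq mult.commute)
    qed
    define p where "p = of_real c * cis \<theta> * of_real c + of_real s * cis (- \<theta>) * of_real s"
    have prod: "h ** rot \<theta> ** h = cmat p (of_real s')"
      unfolding h_def rot_def cmat_mult p_def eq[symmetric]
      by (simp add: cis_cnj complex_eq_iff algebra_simps)
    have "(cmod p)\<^sup>2 = (c\<^sup>2 + s\<^sup>2)\<^sup>2 * (cos \<theta>)\<^sup>2 + (c\<^sup>2 - s\<^sup>2)\<^sup>2 * (sin \<theta>)\<^sup>2"
      unfolding cmod_power2 p_def by (simp add: power2_eq_square algebra_simps)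
    also have "\<dots> = (c\<^sup>2 - s\<^sup>2)\<^sup>2 * ((cos \<theta>)\<^sup>2 + (sin \<theta>)\<^sup>2) + (2 * c * s * cos \<theta>)\<^sup>2"
      by algebra
    also have "\<dots> = 1 + s'\<^sup>2" using c(1) eq by simp
    finally have "cmat p (of_real s') \<in> SU11"
      unfolding SU11_iff_cmat by (intro exI[of _ p] exI[of _ "of_real s'"]) simp
    moreover have "cmat p (of_real s') \<in> S"
      unfolding prod[symmetric] by (intro mult hS rot)
    ultimately show "Q s'" using Q_of_mem[of p "of_real s'"] that(2) by simp
  qed
  have "Q (2 ^ n * cmod b)" for n
  proof (induction n)
    case 0
    show ?case using Q_of_mem[OF extra(1,2)] by simp
  next
    case (Suc n)
    then show ?case by (rule double) auto
  qed
  note pow = this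
  have all: "Q s" if "s \<ge> 0" for s
  proof -
    obtain n where "s / cmod b < 2 ^ n"
      using real_arch_pow[of 2 "s / cmod b"] by auto
    then have "s < 2 ^ n * cmod b" using extra(3) by (simp add: pos_divide_less_eq)
    then have "s \<le> 2 * (2 ^ n * cmod b)" using that by linarith
    then show ?thesis by (rule double[OF pow that])
  qed
  have "cmat c d \<in> S" if "cmat c d \<in> SU11" for c d
    using all[of "cmod d"] that unfolding Q_def by simp
  then show ?thesis by (auto simp: SU11_iff_cmat)
qed

text \<open>
  When \<open>J ** J = - mat 1\<close>, this is the exponential of \<open>\<theta> J\<close>.
\<close>
definition periodic_flow :: "complex^2^2 \<Rightarrow> real \<Rightarrow> complex^2^2" where
  "periodic_flow J \<theta> = cos \<theta> *\<^sub>R mat 1 + sin \<theta> *\<^sub>R J"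

lemma periodic_flow_cmat:
  "periodic_flow (cmat (\<i> * of_real p) \<beta>) \<theta> = cmat (of_real (cos \<theta>) + \<i> * of_real (p * sin \<theta>)) (of_real (sin \<theta>) * \<beta>)"
  by (simp add: periodic_flow_def cmat_one cmat_scaleR cmat_add algebra_simps)

lemma periodic_flow_SU11:
  assumes "p\<^sup>2 - (cmod \<beta>)\<^sup>2 = 1"
  shows "periodic_flow (cmat (\<i> * of_real p) \<beta>) \<theta> \<in> SU11"
proof -
  have "(cmod (of_real (cos \<theta>) + \<i> * of_real (p * sin \<theta>)))\<^sup>2 - (cmod (of_real (sin \<theta>) * \<beta>))\<^sup>2 =
      (cos \<theta>)\<^sup>2 + (sin \<theta>)\<^sup>2 * (p\<^sup>2 - (cmod \<beta>)\<^sup>2)"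
    by (simp add: norm_mult power_mult_distrib cmod_power2[of "_ + _"] algebra_simps)
  also have "\<dots> = 1" using assms by simp
  finally show ?thesis unfolding periodic_flow_cmat SU11_iff_cmat by blast
qed

lemma rot_eq_periodic_flow: "rot \<theta> = periodic_flow (cmat (\<i> * of_real 1) 0) \<theta>"
  unfolding periodic_flow_cmat rot_def by (simp add: complex_eq_iff)

lemma SU11_mult: "X \<in> SU11 \<Longrightarrow> Y \<in> SU11 \<Longrightarrow> X ** Y \<in> SU11"
proof -
  assume "X \<in> SU11" "Y \<in> SU11"
  then obtain a b c d where X: "X = cmat a b" "(cmod a)\<^sup>2 - (cmod b)\<^sup>2 = 1"
    and Y: "Y = cmat c d" "(cmod c)\<^sup>2 - (cmod d)\<^sup>2 = 1" by (auto simp: SU11_iff_cmat)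
  have "(cmod (a * c + b * cnj d))\<^sup>2 - (cmod (a * d + b * cnj c))\<^sup>2 =
     ((cmod a)\<^sup>2 - (cmod b)\<^sup>2) * ((cmod c)\<^sup>2 - (cmod d)\<^sup>2)"
    unfolding cmod_power2 by (simp add: power2_eq_square algebra_simps)
  then have "(cmod (a * c + b * cnj d))\<^sup>2 - (cmod (a * d + b * cnj c))\<^sup>2 = 1" using X(2) Y(2) by simp
  then show ?thesis unfolding X(1) Y(1) cmat_mult SU11_iff_cmat by blast
qed

lemma SU11_inverse:
  assumes "g \<in> SU11"
  obtains g' where "g' \<in> SU11" "g ** g' = mat 1" "g' ** g = mat 1"
proof -
  from assms obtain a b where g: "g = cmat a b" "(cmod a)\<^sup>2 - (cmod b)\<^sup>2 = 1" by (auto simp: SU11_iff_cmat)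
  have "a * cnj a - b * cnj b = 1"
    using g(2) by (simp add: complex_mult_cnj cmod_power2 flip: of_real_add of_real_diff)
  then have "g ** cmat (cnj a) (- b) = mat 1" "cmat (cnj a) (- b) ** g = mat 1"
    by (simp_all add: g(1) cmat_mult cmat_one mult.commute)
  moreover have "cmat (cnj a) (- b) \<in> SU11"
    using g(2) unfolding SU11_iff_cmat by (intro exI[of _ "cnj a"] exI[of _ "- b"]) simp
  ultimately show thesis using that by blast
qed

lemma hyperboloid_complex:
  assumes "p\<^sup>2 - (cmod \<beta>)\<^sup>2 = 1"
  shows "of_real p * of_real p - \<beta> * cnj \<beta> = 1"
proof -
  have "of_real p * of_real p - \<beta> * cnj \<beta> = of_real (p\<^sup>2 - (cmod \<beta>)\<^sup>2)"
    unfolding complex_norm_square[symmetric] by (simp add: power2_eq_square)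
  with assms show ?thesis by simp
qed

text \<open>
  With \<open>J\<close> the given matrix and \<open>J\<^sub>0\<close> the diagonal one, both of square \<open>-1\<close>, the matrix
  \<open>1 - J ** J\<^sub>0\<close> intertwines them. Its determinant is \<open>2 + 2 p\<close>, positive by the sign condition
  on \<open>p\<close>, and division by the square root places it in SU(1,1).
\<close>
lemma elliptic_conjugate_to_rotation:
  assumes "p\<^sup>2 - (cmod \<beta>)\<^sup>2 = 1" "p > 0"
  obtains g where "g \<in> SU11" "cmat (\<i> * of_real p) \<beta> ** g = g ** cmat (\<i> * of_real 1) 0"
proof
  define n where "n = sqrt (2 + 2 * p)"
  have n: "n\<^sup>2 = 2 + 2 * p" "n > 0" using assms(2) by (simp_all add: n_def)
  let ?g = "cmat (of_real ((1 + p) / n)) (\<i> * \<beta> / of_real n)"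
  have "((1 + p) / n)\<^sup>2 - (cmod \<beta> / n)\<^sup>2 = ((1 + p)\<^sup>2 - (cmod \<beta>)\<^sup>2) / n\<^sup>2"
    by (simp add: power_divide diff_divide_distrib)
  also have "(1 + p)\<^sup>2 - (cmod \<beta>)\<^sup>2 = n\<^sup>2"
    using assms(1) n(1) by (simp add: power2_eq_square algebra_simps)
  finally have "((1 + p) / n)\<^sup>2 - (cmod \<beta> / n)\<^sup>2 = 1" using n(2) by simp
  moreover have "(cmod (of_real ((1 + p) / n)))\<^sup>2 = ((1 + p) / n)\<^sup>2"
    by (simp only: norm_of_real power2_abs)
  moreover have "cmod (\<i> * \<beta> / of_real n) = cmod \<beta> / n"
    using n(2) by (simp add: norm_divide norm_mult)
  ultimately have "(cmod (of_real ((1 + p) / n)))\<^sup>2 - (cmod (\<i> * \<beta> / of_real n))\<^sup>2 = 1" by simp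
  then show "?g \<in> SU11" unfolding SU11_iff_cmat by blast
  have "of_real p * (1 + of_real p) - \<beta> * cnj \<beta> = 1 + of_real p"
    using hyperboloid_complex[OF assms(1)] by (simp add: algebra_simps)
  moreover have "\<i> * of_real p * of_real ((1 + p) / n) + \<beta> * cnj (\<i> * \<beta> / of_real n) =
      \<i> * (of_real p * (1 + of_real p) - \<beta> * cnj \<beta>) / of_real n"
    by (simp add: diff_divide_distrib right_diff_distrib mult_ac)
  moreover have "\<i> * of_real p * (\<i> * \<beta> / of_real n) + \<beta> * cnj (of_real ((1 + p) / n)) =
      (\<i> * \<beta> / of_real n) * cnj (\<i> * of_real 1)"
    by (simp add: add_divide_distrib distrib_left mult_ac)
  ultimately show "cmat (\<i> * of_real p) \<beta> ** ?g = ?g ** cmat (\<i> * of_real 1) 0"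
    by (simp add: cmat_mult mult_ac)
qed

section \<open>Steering along elliptic flows\<close>

lemma matrix_mult_scaleR: 
  fixes M N :: "complex^2^2"
  shows "M ** (r *\<^sub>R N) = r *\<^sub>R (M ** N)" "(r *\<^sub>R M) ** N = r *\<^sub>R (M ** N)"
  by (simp_all add: mat_eq_iff_2 matrix_matrix_mult_def sum_2 scaleR_right_distrib)

lemma matrix_mult_add_left: "(L + M) ** N = L ** N + M ** N"
  for L M N :: "complex^2^2"
  by (simp add: mat_eq_iff_2 matrix_matrix_mult_def sum_2 algebra_simps)

lemma periodic_flow_mult:
  fixes Y :: "complex^2^2"
  shows "periodic_flow J \<theta> ** Y = cos \<theta> *\<^sub>R Y + sin \<theta> *\<^sub>R (J ** Y)"
  by (simp add: periodic_flow_def matrix_mult_add_left matrix_mult_scaleR)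

lemma conj_periodic_flow:
  assumes "g ** g' = mat 1"
  shows "g ** periodic_flow J \<theta> ** g' = periodic_flow (g ** J ** g') \<theta>"
  using assms by (simp add: periodic_flow_def matrix_mult_add_left matrix_add_ldistrib matrix_mult_scaleR)

lemma periodic_flow_solution:
  fixes J Y :: "complex^2^2"
  assumes J: "J ** J = - mat 1"
  shows "((\<lambda>t. periodic_flow J (\<omega> * (t - T)) ** Y) has_vector_derivative
     (\<omega> *\<^sub>R J) ** (periodic_flow J (\<omega> * (t - T)) ** Y)) (at t within S)" (is ?deriv)
    and "\<exists>L. L-lipschitz_on {c..d} (\<lambda>t. periodic_flow J (\<omega> * (t - T)) ** Y)" (is ?lip)
proof -
  let ?Z = "\<lambda>t. periodic_flow J (\<omega> * (t - T)) ** Y"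
  let ?D = "\<lambda>t. (- sin (\<omega> * (t - T)) * \<omega>) *\<^sub>R Y + (cos (\<omega> * (t - T)) * \<omega>) *\<^sub>R (J ** Y)"
  have JJ: "J ** (J ** Y) = - Y"
  proof -
    have "J ** (J ** Y) = (- mat 1) ** Y" by (simp add: matrix_mul_assoc J)
    also have "\<dots> = - Y" by (simp add: mat_eq_iff_2 matrix_matrix_mult_def sum_2 mat_def)
    finally show ?thesis .
  qed
  have D: "(\<omega> *\<^sub>R J) ** ?Z t = ?D t" for t
    by (simp add: periodic_flow_mult matrix_add_ldistrib matrix_mult_scaleR JJ algebra_simps)
  have deriv: "(?Z has_vector_derivative ?D t) (at t within S)" for t S
    unfolding periodic_flow_mult
    by (intro has_vector_derivative_add has_vector_derivative_scaleR[where g = "\<lambda>_. _", THEN has_vector_derivative_eq_rhs] has_vector_derivative_const)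
       (auto intro!: derivative_eq_intros)
  then show ?deriv unfolding D .
  have "(\<bar>\<omega>\<bar> * (norm Y + norm (J ** Y)))-lipschitz_on {c..d} ?Z"
  proof (rule bounded_derivative_imp_lipschitz)
    show "(?Z has_derivative (\<lambda>h. h *\<^sub>R ?D t)) (at t within {c..d})" for t
      using deriv by (simp add: has_vector_derivative_def)
    fix t
    have "norm (?D t) \<le> \<bar>sin (\<omega> * (t - T))\<bar> * \<bar>\<omega>\<bar> * norm Y + \<bar>cos (\<omega> * (t - T))\<bar> * \<bar>\<omega>\<bar> * norm (J ** Y)"
      by (rule norm_triangle_le) (simp add: abs_mult)
    also have "\<dots> \<le> 1 * \<bar>\<omega>\<bar> * norm Y + 1 * \<bar>\<omega>\<bar> * norm (J ** Y)"
      by (intro add_mono mult_right_mono) auto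
    finally have "norm (?D t) \<le> \<bar>\<omega>\<bar> * (norm Y + norm (J ** Y))" by (simp add: algebra_simps)
    then show "onorm (\<lambda>h. h *\<^sub>R ?D t) \<le> \<bar>\<omega>\<bar> * (norm Y + norm (J ** Y))"
      by (intro onorm_bound) (auto simp: mult.commute intro: mult_left_mono)
  qed auto
  then show ?lip by blast
qed

text \<open>
  A variant of reachability by particularly regular trajectories: locally Lipschitz, with finitely
  many exceptional times. Unlike absolute continuity, these conditions are easily seen to survive
  concatenation.
\<close>
definition steerable :: "complex^2^2 \<Rightarrow> complex^2^2 \<Rightarrow> complex^2^2 \<Rightarrow> bool" where
  "steerable A B Y \<longleftrightarrow> (\<exists>T u X F. T \<ge> 0 \<and> admissible_control u \<and> X 0 = mat 1 \<and> X T = Y \<and>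
     (\<forall>S\<ge>0. \<exists>L. L-lipschitz_on {0..S} X) \<and> finite F \<and>
     (\<forall>t\<in>{0..} - F. (X has_vector_derivative ((A + u t *\<^sub>R B) ** X t)) (at t within {0..})))"

lemma steerable_imp_reachable:
  assumes "steerable A B Y" "Y \<in> SU11"
  shows "\<exists>T\<ge>0. Y \<in> reachable_set A B T"
proof -
  obtain T u X F where T: "T \<ge> 0" "admissible_control u" "X 0 = mat 1" "X T = Y"
    and lip: "\<And>S. S \<ge> 0 \<Longrightarrow> \<exists>L. L-lipschitz_on {0..S} X" and F: "finite F"
    and deriv: "\<And>t. t \<in> {0..} - F \<Longrightarrow> (X has_vector_derivative ((A + u t *\<^sub>R B) ** X t)) (at t within {0..})"
    using assms(1) unfolding steerable_def by blast
  have "F \<inter> {0..} \<in> null_sets (lebesgue_on {0..})"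
    using F by (simp add: null_sets_restrict_space negligible_iff_null_sets[symmetric] negligible_finite)
  then have "AE t in lebesgue_on {0..}. (X has_vector_derivative ((A + u t *\<^sub>R B) ** X t)) (at t within {0..})"
    by (rule AE_I') (use deriv in auto)
  then have "is_solution A B u X"
    using T(3) lip lipschitz_imp_abs_continuous_on unfolding is_solution_def by blast
  with T assms(2) show ?thesis unfolding reachable_set_def by blast
qed

lemma steerable_id:
  assumes "A + v *\<^sub>R B = \<omega> *\<^sub>R J" "J ** J = - mat 1"
  shows "steerable A B (mat 1)"
proof -
  let ?X = "\<lambda>t. periodic_flow J (\<omega> * (t - 0)) ** mat 1"
  have "?X 0 = mat 1" by (simp add: periodic_flow_def)
  moreover have "admissible_control (\<lambda>_. v)"
    by (auto simp: admissible_control_def image_constant_conv)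
  ultimately show ?thesis
    unfolding steerable_def
    using periodic_flow_solution[OF assms(2), where \<omega> = \<omega> and T = 0 and Y = "mat 1"]
    by (intro exI[of _ 0] exI[of _ "\<lambda>_. v"] exI[of _ ?X] exI[of _ "{}"]) (auto simp: assms(1))
qed

lemma steerable_flow:
  assumes "steerable A B Y" and M: "A + v *\<^sub>R B = \<omega> *\<^sub>R J" and J: "J ** J = - mat 1" and "s \<ge> 0"
  shows "steerable A B (periodic_flow J (\<omega> * s) ** Y)"
proof -
  obtain T u X F where T: "T \<ge> 0" "admissible_control u" "X 0 = mat 1" "X T = Y"
    and lip: "\<And>S. S \<ge> 0 \<Longrightarrow> \<exists>L. L-lipschitz_on {0..S} X" and F: "finite F"
    and deriv: "\<And>t. t \<in> {0..} - F \<Longrightarrow> (X has_vector_derivative ((A + u t *\<^sub>R B) ** X t)) (at t within {0..})"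
    using assms(1) unfolding steerable_def by blast
  define Z where "Z t = periodic_flow J (\<omega> * (t - T)) ** Y" for t
  define X' where "X' t = (if t \<le> T then X t else Z t)" for t
  define u' where "u' t = (if t \<le> T then u t else v)" for t
  have ZT: "Z T = Y" by (simp add: Z_def periodic_flow_def)
  have "admissible_control u'"
    unfolding admissible_control_def
  proof (intro conjI allI impI)
    show "u' \<in> borel_measurable (lebesgue_on {0..})"
      using T(2) unfolding u'_def[abs_def] admissible_control_def
      by (intro measurable_If) (auto simp: sets_restrict_space space_restrict_space intro!: image_eqI[of _ _ "{..T}"])
    fix S :: real assume "S \<ge> 0"
    with T(2) have "bounded (insert v (u ` {0..S}))" by (simp add: admissible_control_def)
    then show "bounded (u' ` {0..S})" by (rule bounded_subset) (auto simp: u'_def)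
  qed
  moreover have "X' 0 = mat 1" using T by (simp add: X'_def)
  moreover have "X' (T + s) = periodic_flow J (\<omega> * s) ** Y"
    using \<open>s \<ge> 0\<close> ZT T(4) by (auto simp: X'_def Z_def periodic_flow_def)
  moreover have "\<exists>L. L-lipschitz_on {0..S} X'" if "S \<ge> 0" for S
  proof -
    obtain L where L: "L-lipschitz_on {0..T} X" using lip T(1) by blast
    obtain M where M: "M-lipschitz_on {T..max S T} Z"
      using periodic_flow_solution(2)[OF J, where c = T and d = "max S T" and \<omega> = \<omega> and T = T and Y = Y] by (auto simp: Z_def[abs_def])
    have "(max L M)-lipschitz_on {0..max S T} X'"
      unfolding X'_def[abs_def] using lipschitz_on_concat_max[OF L M] ZT T(4) by simp
    then show ?thesis using lipschitz_on_subset[of _ "{0..max S T}" X' "{0..S}"] by fastforce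
  qed
  moreover have "(X' has_vector_derivative ((A + u' t *\<^sub>R B) ** X' t)) (at t within {0..})"
    if t: "t \<in> {0..} - insert T F" for t
  proof (cases "t < T")
    case True
    have "(X has_vector_derivative ((A + u' t *\<^sub>R B) ** X' t)) (at t within {0..})"
      using deriv[of t] t True by (simp add: u'_def X'_def)
    then show ?thesis
      by (rule has_vector_derivative_transform_within[where d = "T - t"])
         (use True t in \<open>auto simp: X'_def dist_real_def\<close>)
  next
    case False
    with t have "t > T" by simp
    have "(Z has_vector_derivative ((\<omega> *\<^sub>R J) ** Z t)) (at t within {0..})"
      unfolding Z_def[abs_def] by (rule periodic_flow_solution(1)[OF J])
    then have "(Z has_vector_derivative ((A + u' t *\<^sub>R B) ** X' t)) (at t within {0..})"
      using \<open>t > T\<close> M by (simp add: u'_def X'_def)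
    then show ?thesis
      by (rule has_vector_derivative_transform_within[where d = "t - T"])
         (use \<open>t > T\<close> t in \<open>auto simp: X'_def dist_real_def\<close>)
  qed
  ultimately show ?thesis
    unfolding steerable_def using T(1) \<open>s \<ge> 0\<close> F
    by (intro exI[of _ "T + s"] exI[of _ u'] exI[of _ X'] exI[of _ "insert T F"]) auto
qed

text \<open>
  Elliptic flows are periodic, so that moving backwards in time amounts to moving forwards longer.
\<close>
lemma steerable_full_circle:
  assumes "steerable A B Y" and "A + v *\<^sub>R B = \<omega> *\<^sub>R J" and "J ** J = - mat 1" and "\<omega> \<noteq> 0"
  shows "steerable A B (periodic_flow J \<theta> ** Y)"
proof -
  define k :: int where "k = (if \<omega> > 0 then \<lceil>\<bar>\<theta>\<bar>\<rceil> else - \<lceil>\<bar>\<theta>\<bar>\<rceil>)"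
  have "\<bar>\<theta>\<bar> \<le> 1 * real_of_int \<lceil>\<bar>\<theta>\<bar>\<rceil>" by linarith
  also have "\<dots> \<le> (2 * pi) * real_of_int \<lceil>\<bar>\<theta>\<bar>\<rceil>"
    using pi_gt3 by (intro mult_right_mono) auto
  finally have "(\<theta> + 2 * pi * real_of_int k) / \<omega> \<ge> 0"
    using assms(4) by (auto simp: k_def zero_le_divide_iff)
  from steerable_flow[OF assms(1-3) this]
  have "steerable A B (periodic_flow J (\<theta> + 2 * pi * real_of_int k) ** Y)" using assms(4) by simp
  also have "periodic_flow J (\<theta> + 2 * pi * real_of_int k) = periodic_flow J \<theta>"
    by (simp add: periodic_flow_def cos_add sin_add)
  finally show ?thesis .
qed

text \<open>
  Allowing \<open>\<omega>\<close> to be negative makes it possible to have \<open>p > 0\<close>.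
\<close>
lemma elliptic_normal_form:
  assumes "(cmod \<beta>)\<^sup>2 < m\<^sup>2"
  obtains \<omega> p \<beta>' where "\<omega> \<noteq> 0" "p > 0" "p\<^sup>2 - (cmod \<beta>')\<^sup>2 = 1"
    "cmat (\<i> * of_real m) \<beta> = \<omega> *\<^sub>R cmat (\<i> * of_real p) \<beta>'"
proof -
  define r where "r = sqrt (m\<^sup>2 - (cmod \<beta>)\<^sup>2)"
  have r: "r > 0" "r\<^sup>2 = m\<^sup>2 - (cmod \<beta>)\<^sup>2" using assms by (simp_all add: r_def)
  have m: "m \<noteq> 0" using assms by auto
  define \<omega> where "\<omega> = sgn m * r"
  have w: "\<omega> \<noteq> 0" "\<omega>\<^sup>2 = r\<^sup>2" "m / \<omega> > 0"
    using m r by (auto simp: \<omega>_def sgn_if power_mult_distrib zero_less_divide_iff)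
  have "(m / \<omega>)\<^sup>2 - (cmod (\<beta> / of_real \<omega>))\<^sup>2 = (m\<^sup>2 - (cmod \<beta>)\<^sup>2) / \<omega>\<^sup>2"
    by (simp add: norm_divide power_divide diff_divide_distrib)
  also have "\<dots> = 1" using r w(1) unfolding w(2) r(2)[symmetric] by simp
  finally show thesis
    using w(1,3) by (intro that[of \<omega> "m / \<omega>" "\<beta> / of_real \<omega>"]) (simp_all add: cmat_scaleR)
qed

lemma elliptic_square:
  assumes "p\<^sup>2 - (cmod \<beta>)\<^sup>2 = 1"
  shows "cmat (\<i> * of_real p) \<beta> ** cmat (\<i> * of_real p) \<beta> = - mat 1"
proof -
  have "of_real p * of_real p - \<beta> * cnj \<beta> = 1"
    using assms by (rule hyperboloid_complex)
  then show ?thesis by (simp add: mat_eq_iff_2 cmat_mult mat_def algebra_simps)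
qed

lemma SU11_conj_su11:
  assumes "g \<in> SU11" "g' \<in> SU11" "g ** g' = mat 1"
  obtains \<alpha>' \<beta>' where "g' ** cmat (\<i> * of_real \<alpha>) \<beta> ** g = cmat (\<i> * of_real \<alpha>') \<beta>'"
proof -
  let ?M = "cmat (\<i> * of_real \<alpha>) \<beta>"
  obtain x y where xy: "g' ** ?M ** g = cmat x y"
    using assms(1,2) by (auto simp: SU11_iff_cmat cmat_mult)
  have "trace (g' ** ?M ** g) = trace (g ** (g' ** ?M))" by (rule trace_mul_sym)
  also have "\<dots> = trace ?M" by (simp add: matrix_mul_assoc assms(3))
  also have "\<dots> = 0" by (simp add: trace_def sum_2)
  finally have "x = \<i> * of_real (Im x)"
    by (simp add: xy trace_def sum_2 complex_eq_iff)
  then show thesis using that[of "Im x" y] xy by metis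
qed

text \<open>
  Conjugation takes an elliptic \<open>A + v B\<close> to a multiple of the generator of the rotations. Since
  \<open>A\<close> and \<open>B\<close> are independent, the conjugate of \<open>B\<close> is not diagonal, and a small change of \<open>v\<close>
  yields a second elliptic flow about another fixed point. The matrices whose left multiplication
  preserves steerability form a monoid containing both flows, hence all of SU(1,1).
\<close>
lemma Omega_nonempty_imp_controllable:
  assumes A: "A = cmat (\<i> * of_real a) b" and B: "B = cmat (\<i> * of_real \<alpha>) \<beta>"
    and indep: "\<And>s t. s *\<^sub>R A + t *\<^sub>R B = 0 \<Longrightarrow> s = 0 \<and> t = 0"
    and "Omega A B \<noteq> {}"
  shows "controllable A B"
proof -
  obtain v where "v \<in> Omega A B" using assms(4) by blast
  then have "(cmod (b + of_real v * \<beta>))\<^sup>2 < (a + v * \<alpha>)\<^sup>2" by (simp add: A B Omega_cmat_iff)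
  then obtain \<omega> p \<beta>1 where w: "\<omega> \<noteq> 0" and p: "p > 0" "p\<^sup>2 - (cmod \<beta>1)\<^sup>2 = 1"
    and "cmat (\<i> * of_real (a + v * \<alpha>)) (b + of_real v * \<beta>) = \<omega> *\<^sub>R cmat (\<i> * of_real p) \<beta>1"
    by (rule elliptic_normal_form)
  define J where "J = cmat (\<i> * of_real p) \<beta>1"
  have J: "J ** J = - mat 1" unfolding J_def using p(2) by (rule elliptic_square)
  have M: "A + v *\<^sub>R B = \<omega> *\<^sub>R J"
    unfolding J_def \<open>_ = \<omega> *\<^sub>R _\<close>[symmetric] by (simp add: A B cmat_add cmat_scaleR algebra_simps)
  let ?J0 = "cmat (\<i> * of_real 1) 0"
  obtain g where g: "g \<in> SU11" "J ** g = g ** ?J0"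
    unfolding J_def using elliptic_conjugate_to_rotation[OF p(2,1)] by blast
  obtain g' where g': "g' \<in> SU11" "g ** g' = mat 1" "g' ** g = mat 1"
    using g(1) by (rule SU11_inverse)
  have gJ: "g ** ?J0 ** g' = J"
    unfolding g(2)[symmetric] by (simp add: matrix_mul_assoc[symmetric] g'(2))
  have unconj: "g ** (g' ** N ** g) ** g' = N" for N
    by (metis g'(2) matrix_mul_assoc matrix_mul_lid matrix_mul_rid)
  obtain \<alpha>' \<beta>' where B': "g' ** B ** g = cmat (\<i> * of_real \<alpha>') \<beta>'"
    unfolding B using SU11_conj_su11[OF g(1) g'(1,2)] .
  have "\<beta>' \<noteq> 0"
  proof
    assume "\<beta>' = 0"
    then have "g' ** B ** g = \<alpha>' *\<^sub>R ?J0" by (simp add: B' cmat_scaleR)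
    then have "B = \<alpha>' *\<^sub>R J"
      using unconj[of B] by (simp add: matrix_mult_scaleR gJ del: of_real_1)
    then have "\<alpha>' *\<^sub>R A + (\<alpha>' * v - \<omega>) *\<^sub>R B = \<alpha>' *\<^sub>R (A + v *\<^sub>R B) - \<omega> *\<^sub>R (\<alpha>' *\<^sub>R J)"
      by (simp add: algebra_simps)
    also have "\<dots> = 0" by (simp add: M)
    finally have "\<alpha>' = 0 \<and> \<alpha>' * v - \<omega> = 0" by (rule indep)
    with w show False by auto
  qed
  \<comment> \<open>Small enough to keep \<open>A + (v + \<epsilon>) B\<close> elliptic.\<close>
  define \<epsilon> where "\<epsilon> = \<omega> / (2 * (\<bar>\<alpha>'\<bar> + cmod \<beta>'))"
  have pos: "\<bar>\<alpha>'\<bar> + cmod \<beta>' > 0" using \<open>\<beta>' \<noteq> 0\<close> by (simp add: add_nonneg_pos)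
  have \<epsilon>: "\<epsilon> \<noteq> 0" using w pos by (simp add: \<epsilon>_def)
  have "\<bar>\<epsilon>\<bar> * (\<bar>\<alpha>'\<bar> + cmod \<beta>') = \<bar>\<omega>\<bar> / 2"
  proof -
    have "\<bar>\<epsilon>\<bar> = \<bar>\<omega>\<bar> / (2 * (\<bar>\<alpha>'\<bar> + cmod \<beta>'))"
      using pos by (simp only: \<epsilon>_def abs_divide abs_mult abs_of_pos abs_numeral)
    with pos show ?thesis by (simp only: times_divide_eq_left) (simp add: divide_eq_eq)
  qed
  then have "\<bar>\<epsilon> * \<alpha>'\<bar> + \<bar>\<epsilon>\<bar> * cmod \<beta>' < \<bar>\<omega>\<bar>"
    using w by (simp add: abs_mult distrib_left)
  then have "\<bar>\<epsilon>\<bar> * cmod \<beta>' < \<bar>\<omega> + \<epsilon> * \<alpha>'\<bar>" by linarith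
  then have "(cmod (of_real \<epsilon> * \<beta>'))\<^sup>2 < \<bar>\<omega> + \<epsilon> * \<alpha>'\<bar>\<^sup>2"
    by (intro power_strict_mono) (simp_all add: norm_mult)
  then have "(cmod (of_real \<epsilon> * \<beta>'))\<^sup>2 < (\<omega> + \<epsilon> * \<alpha>')\<^sup>2" by (simp only: power2_abs)
  then obtain \<omega>2 p2 \<beta>2 where w2: "\<omega>2 \<noteq> 0" and p2: "p2\<^sup>2 - (cmod \<beta>2)\<^sup>2 = 1"
    and eq2: "cmat (\<i> * of_real (\<omega> + \<epsilon> * \<alpha>')) (of_real \<epsilon> * \<beta>') = \<omega>2 *\<^sub>R cmat (\<i> * of_real p2) \<beta>2"
    by (rule elliptic_normal_form)
  define J2 where "J2 = g ** cmat (\<i> * of_real p2) \<beta>2 ** g'"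
  have "\<beta>2 \<noteq> 0" using eq2 \<epsilon> \<open>\<beta>' \<noteq> 0\<close> by (auto simp: cmat_scaleR)
  have J2: "J2 ** J2 = - mat 1"
  proof -
    let ?K = "cmat (\<i> * of_real p2) \<beta>2"
    have "J2 ** J2 = g ** (?K ** (g' ** g) ** ?K) ** g'"
      by (simp only: J2_def matrix_mul_assoc)
    also have "\<dots> = g ** ((- 1) *\<^sub>R mat 1) ** g'"
      by (simp add: g'(3) elliptic_square[OF p2])
    also have "\<dots> = - mat 1" by (simp only: matrix_mult_scaleR matrix_mul_rid g'(2)) simp
    finally show ?thesis .
  qed
  have M2: "A + (v + \<epsilon>) *\<^sub>R B = \<omega>2 *\<^sub>R J2"
  proof -
    have "A + (v + \<epsilon>) *\<^sub>R B = \<omega> *\<^sub>R J + \<epsilon> *\<^sub>R B" by (simp add: M[symmetric] algebra_simps)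
    also have "\<dots> = g ** (\<omega> *\<^sub>R ?J0 + \<epsilon> *\<^sub>R cmat (\<i> * of_real \<alpha>') \<beta>') ** g'"
      by (simp only: matrix_add_ldistrib matrix_mult_add_left matrix_mult_scaleR gJ B'[symmetric] unconj)
    also have "\<omega> *\<^sub>R ?J0 + \<epsilon> *\<^sub>R cmat (\<i> * of_real \<alpha>') \<beta>' = \<omega>2 *\<^sub>R cmat (\<i> * of_real p2) \<beta>2"
      unfolding eq2[symmetric] by (simp add: cmat_add cmat_scaleR algebra_simps)
    finally show ?thesis by (simp only: matrix_mult_scaleR J2_def)
  qed
  define S where "S = {h. \<forall>Y. steerable A B Y \<longrightarrow> steerable A B (g ** h ** g' ** Y)}"
  have "SU11 \<subseteq> S"
  proof (rule rotations_and_one_more_generate_SU11)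
    show "X ** Y \<in> S" if "X \<in> S" "Y \<in> S" for X Y
    proof -
      have cancel: "N ** g' ** g = N" for N :: "complex^2^2"
        by (simp add: matrix_mul_assoc[symmetric] g'(3))
      have "g ** (X ** Y) ** g' ** Z = g ** X ** g' ** (g ** Y ** g' ** Z)" for Z :: "complex^2^2"
        by (simp only: matrix_mul_assoc cancel)
      with that show ?thesis by (simp add: S_def)
    qed
    show "rot \<theta> \<in> S" for \<theta>
      unfolding S_def rot_eq_periodic_flow mem_Collect_eq conj_periodic_flow[OF g'(2)] gJ
      using steerable_full_circle[OF _ M J w] by blast
    \<comment> \<open>The quarter turn of the second flow is the complex structure itself, which is not diagonal.\<close>
    have flow: "periodic_flow (cmat (\<i> * of_real p2) \<beta>2) (pi / 2) = cmat (\<i> * of_real p2) \<beta>2"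
      by (simp add: periodic_flow_def)
    have "periodic_flow (cmat (\<i> * of_real p2) \<beta>2) (pi / 2) \<in> S"
      unfolding S_def mem_Collect_eq conj_periodic_flow[OF g'(2)] J2_def[symmetric]
      using steerable_full_circle[OF _ M2 J2 w2] by blast
    then show "cmat (\<i> * of_real p2) \<beta>2 \<in> S" unfolding flow .
    show "cmat (\<i> * of_real p2) \<beta>2 \<in> SU11"
      using periodic_flow_SU11[OF p2, of "pi / 2"] unfolding flow .
  qed fact
  have "steerable A B Y" if "Y \<in> SU11" for Y
  proof -
    have "g' ** Y ** g \<in> S" using \<open>SU11 \<subseteq> S\<close> SU11_mult that g(1) g'(1) by blast
    then have "steerable A B (g ** (g' ** Y ** g) ** g' ** mat 1)"
      unfolding S_def using steerable_id[OF M J] by blast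
    then show ?thesis unfolding unconj by simp
  qed
  then have "SU11 \<subseteq> (\<Union>t\<in>{0..}. reachable_set A B t)"
    using steerable_imp_reachable by fastforce
  then show ?thesis unfolding controllable_def reachable_set_def by blast
qed

section \<open>The controllability criterion\<close>

theorem mainTheorem1:
  fixes A B :: "complex^2^2"
  assumes "A \<in> su11" and "B \<in> su11"
    and "A \<noteq> B" and "independent {A, B}"
  shows "controllable A B \<longleftrightarrow> Omega A B \<noteq> {}"
proof -
  obtain a b where A: "A = cmat (\<i> * of_real a) b" using assms(1) by (rule su11_cmat)
  obtain \<alpha> \<beta> where B: "B = cmat (\<i> * of_real \<alpha>) \<beta>" using assms(2) by (rule su11_cmat)
  have indep: "s = 0 \<and> t = 0" if "s *\<^sub>R A + t *\<^sub>R B = 0" for s t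
  proof -
    let ?c = "\<lambda>M. if M = A then s else t"
    have sum0: "(\<Sum>M\<in>{A, B}. ?c M *\<^sub>R M) = 0" using that assms(3) by simp
    have coeff: "c M = 0" if "(\<Sum>M\<in>{A, B}. c M *\<^sub>R M) = 0" "M \<in> {A, B}" for c M
      using assms(4) that unfolding independent_explicit by blast
    have "?c A = 0" "?c B = 0" by (rule coeff[OF sum0]; simp)+
    with assms(3) show ?thesis by simp
  qed
  have "B \<noteq> 0" using indep[of 0 1] by auto
  then show ?thesis
    using controllable_imp_Omega_nonempty[OF A B] Omega_nonempty_imp_controllable[OF A B indep] by blast
qed

end
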